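(* Let $\Gamma$ be a set of labelled formulas and $\alpha:\phi$ a labelled formula. If $\Gamma\vDash\alpha:\phi$, then $\Gamma\vdash\alpha:\phi$ (derivability in the labelled natural deduction system for LTP).
   Context: **Semantics.** Boolean algebras $B$ are written with operations $0,1,-,+,\cdot$ (bottom, top, complement, join, meet); the one-element Boolean algebra is allowed. The powerset $\mathcal{P}(B)$ carries external operations $\bot=\emptyset$, $\neg X=B\setminus X$, $X\vee Y=X\cup Y$, $X\wedge Y=X\cap Y$, and internal operations $\dot\bot=\{0\}$, $\dot\neg X=\{-a\mid a\in X\}$, $X\mathbin{\dot\vee}Y=\{a+b\mid a\in X,b\in Y\}$, $X\mathbin{\dot\wedge}Y=\{a\cdot b\mid a\in X,b\in Y\}$. The formulas of LTP form the absolutely free algebra $\mathrm{Fm}$ generated by propositional variables $P_0,P_1,\dots$ using constants $\bot,\dot\bot$, unary $\neg,\dot\neg$, and binary $\vee,\wedge,\dot\vee,\dot\wedge$. Put $\dot\top:=\dot\neg\dot\bot$. Homomorphisms $H:\mathrm{Fm}\to\mathcal{P}(B)$ preserve all eight operations. **Labels.** Labels form the absolutely free algebra $\mathrm{Lb}$ generated by atomic labels $p_0,p_1,\dots$ using $0$, unary $-$, binary $+,\cdot$ (i.e. they are classical propositional formulas, with $0$ falsum, $-$ negation, $+$ disjunction, $\cdot$ conjunction). Homomorphisms $h:\mathrm{Lb}\to B$ preserve $0,-,+,\cdot$. A labelled formula is a pair $\alpha:\phi$ with $\alpha\in\mathrm{Lb}$, $\phi\in\mathrm{Fm}$. $\alpha\leftrightarrow\beta$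 abbreviates $(\alpha+-\beta)\cdot(-\alpha+\beta)$, and $\alpha=\beta$ abbreviates the labelled formula $(\alpha\leftrightarrow\beta):\dot\top$. **Entailment.** $\Gamma\vDash\beta:\psi$ iff for all Boolean algebras $B$ and homomorphisms $h:\mathrm{Lb}\to B$, $H:\mathrm{Fm}\to\mathcal{P}(B)$: if $h(\alpha)\in H(\phi)$ for all $\alpha:\phi\in\Gamma$, then $h(\beta)\in H(\psi)$. **Deduction system.** $\Gamma\vdash\alpha:\phi$ means there is a natural deduction tree with conclusion $\alpha:\phi$ whose undischarged assumptions all lie in $\Gamma$, using the following rules ($\alpha,\beta,\alpha_i$ arbitrary labels, $\phi,\psi,\sigma$ arbitrary formulas; vacuous discharge allowed): - taut: from $\alpha_1:\dot\top,\dots,\alpha_k:\dot\top$ ($k\ge 0$) infer $\beta:\dot\top$, provided $\alpha_1,\dots,\alpha_k\vdash\beta$ in classical propositional logic. - sub: from $\alpha=\beta$ and $\alpha:\phi$ infer $\beta:\phi$. - $\wedge$I: from $\alpha:\phi$ and $\alpha:\psi$ infer $\alpha:\phi\wedge\psi$. $\wedge$E: from $\alpha:\phi\wedge\psi$ infer $\alpha:\phi$; likewise infer $\alpha:\psi$. - $\vee$I: from $\alpha:\phi$ infer $\alpha:\phi\vee\psi$; from $\alpha:\psi$ infer $\alpha:\phi\vee\psi$. $\vee$E: from $\alpha:\phi\vee\psi$, a derivation of $\beta:\sigma$ from $[\alpha:\phi]$, and a derivation of $\beta:\sigma$ from $[\alpha:\psi]$, infer $\beta:\sigma$ (bracketed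 assumptions discharged). - $\neg$I: from a derivation of $\beta:\bot$ from $[\alpha:\phi]$ infer $\alpha:\neg\phi$. $\neg$E: from $\alpha:\phi$ and $\alpha:\neg\phi$ infer $\beta:\bot$. - RAA: from a derivation of $\beta:\bot$ from $[\alpha:\neg\phi]$ infer $\alpha:\phi$. $\bot$E: from $\alpha:\bot$ infer $\beta:\phi$. - $\dot\wedge$I: from $\alpha:\phi$ and $\beta:\psi$ infer $\alpha\cdot\beta:\phi\mathbin{\dot\wedge}\psi$. $\dot\wedge$E: from $\alpha:\phi\mathbin{\dot\wedge}\psi$ and a derivation of $\beta:\sigma$ from $[p:\phi],[q:\psi],[\alpha=p\cdot q]$ infer $\beta:\sigma$. - $\dot\vee$I: from $\alpha:\phi$ and $\beta:\psi$ infer $\alpha+\beta:\phi\mathbin{\dot\vee}\psi$. $\dot\vee$E: from $\alpha:\phi\mathbin{\dot\vee}\psi$ and a derivation of $\beta:\sigma$ from $[p:\phi],[q:\psi],[\alpha=p+q]$ infer $\beta:\sigma$. - $\dot\neg$I: from $\alpha:\phi$ infer $-\alpha:\dot\neg\phi$. $\dot\neg$E: from $\alpha:\dot\neg\phi$ infer $-\alpha:\phi$. In $\dot\wedge$E and $\dot\vee$E, $p$ and $q$ are distinct atomic labels that do not occur in any uncancelled assumption (other than the bracketed ones discharged by the rule), nor in $\alpha$ or $\beta$. *)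

theory Defs
  imports Main
begin

datatype lb =
    Atom nat
  | LZero
  | LNeg lb  (\<open>\<ominus> _\<close> [81] 80)
  | LPlus lb lb  (infixl \<open>\<oplus>\<close> 65)
  | LTimes lb lb  (infixl \<open>\<odot>\<close> 70)

primrec atoms :: "lb \<Rightarrow> nat set" where
  "atoms (Atom p) = {p}"
| "atoms LZero = {}"
| "atoms (\<ominus> \<alpha>) = atoms \<alpha>"
| "atoms (\<alpha> \<oplus> \<beta>) = atoms \<alpha> \<union> atoms \<beta>"
| "atoms (\<alpha> \<odot> \<beta>) = atoms \<alpha> \<union> atoms \<beta>"

text \<open>The constructors with prefix D are the dotted (internal) connectives.\<close>

datatype fm =
    PVar nat
  | Bot
  | Neg fm
  | Or fm fm
  | And fm fm
  | DBot
  | DNeg fm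
  | DOr fm fm
  | DAnd fm fm

definition DTop :: fm where
  "DTop = DNeg DBot"

type_synonym lfm = "lb \<times> fm"

definition liff :: "lb \<Rightarrow> lb \<Rightarrow> lb" where
  "liff \<alpha> \<beta> = (\<alpha> \<oplus> \<ominus> \<beta>) \<odot> (\<ominus> \<alpha> \<oplus> \<beta>)"

definition leq :: "lb \<Rightarrow> lb \<Rightarrow> lfm"  (infix \<open>\<doteq>\<close> 50) where
  "(\<alpha> \<doteq> \<beta>) = (liff \<alpha> \<beta>, DTop)"


text \<open>
  Boolean algebras with an explicit carrier, so that algebras of every cardinality up to that
  of the type \<open>'b\<close> are available. The axioms are those of the library locale
  \<^locale>\<open>abstract_boolean_algebra\<close>, relativised to the carrier; in particular \<open>0 = 1\<close> is allowed.
\<close>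

record 'b ba =
  carr :: "'b set"
  zero :: 'b
  one :: 'b
  compl :: "'b \<Rightarrow> 'b"
  join :: "'b \<Rightarrow> 'b \<Rightarrow> 'b"
  meet :: "'b \<Rightarrow> 'b \<Rightarrow> 'b"

definition boolean_alg :: "'b ba \<Rightarrow> bool" where
  "boolean_alg B \<longleftrightarrow>
     zero B \<in> carr B \<and> one B \<in> carr B \<and>
     (\<forall>x\<in>carr B. compl B x \<in> carr B) \<and>
     (\<forall>x\<in>carr B. \<forall>y\<in>carr B. join B x y \<in> carr B \<and> meet B x y \<in> carr B) \<and>
     (\<forall>x\<in>carr B. \<forall>y\<in>carr B. \<forall>z\<in>carr B.
        join B (join B x y) z = join B x (join B y z) \<and>
        meet B (meet B x y) z = meet B x (meet B y z)) \<and>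
     (\<forall>x\<in>carr B. \<forall>y\<in>carr B. join B x y = join B y x \<and> meet B x y = meet B y x) \<and>
     (\<forall>x\<in>carr B. \<forall>y\<in>carr B. \<forall>z\<in>carr B.
        meet B x (join B y z) = join B (meet B x y) (meet B x z) \<and>
        join B x (meet B y z) = meet B (join B x y) (join B x z)) \<and>
     (\<forall>x\<in>carr B. meet B x (one B) = x \<and> join B x (zero B) = x) \<and>
     (\<forall>x\<in>carr B. meet B x (compl B x) = zero B \<and> join B x (compl B x) = one B)"

definition lb_hom :: "'b ba \<Rightarrow> (lb \<Rightarrow> 'b) \<Rightarrow> bool" where
  "lb_hom B h \<longleftrightarrow>
     range h \<subseteq> carr B \<and>
     h LZero = zero B \<and>
     (\<forall>\<alpha>. h (\<ominus> \<alpha>) = compl B (h \<alpha>)) \<and>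
     (\<forall>\<alpha> \<beta>. h (\<alpha> \<oplus> \<beta>) = join B (h \<alpha>) (h \<beta>)) \<and>
     (\<forall>\<alpha> \<beta>. h (\<alpha> \<odot> \<beta>) = meet B (h \<alpha>) (h \<beta>))"

definition fm_hom :: "'b ba \<Rightarrow> (fm \<Rightarrow> 'b set) \<Rightarrow> bool" where
  "fm_hom B H \<longleftrightarrow>
     range H \<subseteq> Pow (carr B) \<and>
     H Bot = {} \<and>
     (\<forall>\<phi>. H (Neg \<phi>) = carr B - H \<phi>) \<and>
     (\<forall>\<phi> \<psi>. H (Or \<phi> \<psi>) = H \<phi> \<union> H \<psi>) \<and>
     (\<forall>\<phi> \<psi>. H (And \<phi> \<psi>) = H \<phi> \<inter> H \<psi>) \<and>
     H DBot = {zero B} \<and>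
     (\<forall>\<phi>. H (DNeg \<phi>) = {compl B a |a. a \<in> H \<phi>}) \<and>
     (\<forall>\<phi> \<psi>. H (DOr \<phi> \<psi>) = {join B a b |a b. a \<in> H \<phi> \<and> b \<in> H \<psi>}) \<and>
     (\<forall>\<phi> \<psi>. H (DAnd \<phi> \<psi>) = {meet B a b |a b. a \<in> H \<phi> \<and> b \<in> H \<psi>})"

text \<open>
  Entailment over all Boolean algebras whose carrier is a subset of the type \<open>'b\<close>. HOL cannot
  quantify over types inside a formula, so the universe \<open>'b\<close> is a parameter of the relation;
  entailment over all Boolean algebras is its conjunction over all \<open>'b\<close>.
\<close>

definition entails :: "'b itself \<Rightarrow> lfm set \<Rightarrow> lfm \<Rightarrow> bool" where
  "entails (_ :: 'b itself) \<Gamma> x \<longleftrightarrow>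
     (\<forall>(B :: 'b ba) h H.
        boolean_alg B \<longrightarrow> lb_hom B h \<longrightarrow> fm_hom B H \<longrightarrow>
        (\<forall>(\<alpha>, \<phi>) \<in> \<Gamma>. h \<alpha> \<in> H \<phi>) \<longrightarrow> h (fst x) \<in> H (snd x))"


text \<open>Natural deduction for classical propositional logic on labels.\<close>

inductive cpl :: "lb set \<Rightarrow> lb \<Rightarrow> bool" where
  cpl_assm: "\<alpha> \<in> A \<Longrightarrow> cpl A \<alpha>"
| cpl_conjI: "cpl A \<alpha> \<Longrightarrow> cpl A \<beta> \<Longrightarrow> cpl A (\<alpha> \<odot> \<beta>)"
| cpl_conjE1: "cpl A (\<alpha> \<odot> \<beta>) \<Longrightarrow> cpl A \<alpha>"
| cpl_conjE2: "cpl A (\<alpha> \<odot> \<beta>) \<Longrightarrow> cpl A \<beta>"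
| cpl_disjI1: "cpl A \<alpha> \<Longrightarrow> cpl A (\<alpha> \<oplus> \<beta>)"
| cpl_disjI2: "cpl A \<beta> \<Longrightarrow> cpl A (\<alpha> \<oplus> \<beta>)"
| cpl_disjE: "cpl A (\<alpha> \<oplus> \<beta>) \<Longrightarrow> cpl (insert \<alpha> A) \<gamma> \<Longrightarrow> cpl (insert \<beta> A) \<gamma> \<Longrightarrow> cpl A \<gamma>"
| cpl_negI: "cpl (insert \<alpha> A) LZero \<Longrightarrow> cpl A (\<ominus> \<alpha>)"
| cpl_negE: "cpl A \<alpha> \<Longrightarrow> cpl A (\<ominus> \<alpha>) \<Longrightarrow> cpl A LZero"
| cpl_botE: "cpl A LZero \<Longrightarrow> cpl A \<alpha>"
| cpl_raa: "cpl (insert (\<ominus> \<alpha>) A) LZero \<Longrightarrow> cpl A \<alpha>"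

definition fresh :: "nat \<Rightarrow> lfm set \<Rightarrow> bool" where
  "fresh p \<Delta> \<longleftrightarrow> (\<forall>(\<gamma>, \<chi>) \<in> \<Delta>. p \<notin> atoms \<gamma>)"

text \<open>
  \<open>deriv \<Delta> x\<close>: there is a deduction tree with conclusion \<open>x\<close> whose set of undischarged
  assumptions is exactly \<open>\<Delta>\<close>. A discharge removes the bracketed assumptions from the set of open
  assumptions of the subderivation in question; set difference makes vacuous discharge possible.
  In \<open>taut\<close>, \<open>D \<alpha>\<close> is the set of open assumptions of the derivation of the premise \<open>\<alpha> : DTop\<close>.
  In \<open>dandE\<close> and \<open>dorE\<close>, the set \<open>\<Theta>\<close> consists of the uncancelled assumptions of the subderivation
  of \<open>\<beta> : \<sigma>\<close> other than those discharged by the rule.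
\<close>

inductive deriv :: "lfm set \<Rightarrow> lfm \<Rightarrow> bool" where
  assm: "deriv {x} x"
| taut: "finite A \<Longrightarrow> (\<And>\<alpha>. \<alpha> \<in> A \<Longrightarrow> deriv (D \<alpha>) (\<alpha>, DTop)) \<Longrightarrow> cpl A \<beta> \<Longrightarrow>
    deriv (\<Union>\<alpha>\<in>A. D \<alpha>) (\<beta>, DTop)"
| sub: "deriv \<Delta>\<^sub>1 (\<alpha> \<doteq> \<beta>) \<Longrightarrow> deriv \<Delta>\<^sub>2 (\<alpha>, \<phi>) \<Longrightarrow> deriv (\<Delta>\<^sub>1 \<union> \<Delta>\<^sub>2) (\<beta>, \<phi>)"
| andI: "deriv \<Delta>\<^sub>1 (\<alpha>, \<phi>) \<Longrightarrow> deriv \<Delta>\<^sub>2 (\<alpha>, \<psi>) \<Longrightarrow> deriv (\<Delta>\<^sub>1 \<union> \<Delta>\<^sub>2) (\<alpha>, And \<phi> \<psi>)"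
| andE1: "deriv \<Delta> (\<alpha>, And \<phi> \<psi>) \<Longrightarrow> deriv \<Delta> (\<alpha>, \<phi>)"
| andE2: "deriv \<Delta> (\<alpha>, And \<phi> \<psi>) \<Longrightarrow> deriv \<Delta> (\<alpha>, \<psi>)"
| orI1: "deriv \<Delta> (\<alpha>, \<phi>) \<Longrightarrow> deriv \<Delta> (\<alpha>, Or \<phi> \<psi>)"
| orI2: "deriv \<Delta> (\<alpha>, \<psi>) \<Longrightarrow> deriv \<Delta> (\<alpha>, Or \<phi> \<psi>)"
| orE: "deriv \<Delta>\<^sub>1 (\<alpha>, Or \<phi> \<psi>) \<Longrightarrow> deriv \<Delta>\<^sub>2 (\<beta>, \<sigma>) \<Longrightarrow> deriv \<Delta>\<^sub>3 (\<beta>, \<sigma>) \<Longrightarrow>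
    deriv (\<Delta>\<^sub>1 \<union> (\<Delta>\<^sub>2 - {(\<alpha>, \<phi>)}) \<union> (\<Delta>\<^sub>3 - {(\<alpha>, \<psi>)})) (\<beta>, \<sigma>)"
| negI: "deriv \<Delta> (\<beta>, Bot) \<Longrightarrow> deriv (\<Delta> - {(\<alpha>, \<phi>)}) (\<alpha>, Neg \<phi>)"
| negE: "deriv \<Delta>\<^sub>1 (\<alpha>, \<phi>) \<Longrightarrow> deriv \<Delta>\<^sub>2 (\<alpha>, Neg \<phi>) \<Longrightarrow> deriv (\<Delta>\<^sub>1 \<union> \<Delta>\<^sub>2) (\<beta>, Bot)"
| raa: "deriv \<Delta> (\<beta>, Bot) \<Longrightarrow> deriv (\<Delta> - {(\<alpha>, Neg \<phi>)}) (\<alpha>, \<phi>)"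
| botE: "deriv \<Delta> (\<alpha>, Bot) \<Longrightarrow> deriv \<Delta> (\<beta>, \<phi>)"
| dandI: "deriv \<Delta>\<^sub>1 (\<alpha>, \<phi>) \<Longrightarrow> deriv \<Delta>\<^sub>2 (\<beta>, \<psi>) \<Longrightarrow> deriv (\<Delta>\<^sub>1 \<union> \<Delta>\<^sub>2) (\<alpha> \<odot> \<beta>, DAnd \<phi> \<psi>)"
| dandE: "deriv \<Delta>\<^sub>1 (\<alpha>, DAnd \<phi> \<psi>) \<Longrightarrow> deriv \<Delta>\<^sub>2 (\<beta>, \<sigma>) \<Longrightarrow>
    \<Theta> = \<Delta>\<^sub>2 - {(Atom p, \<phi>), (Atom q, \<psi>), \<alpha> \<doteq> Atom p \<odot> Atom q} \<Longrightarrow>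
    p \<noteq> q \<Longrightarrow> fresh p \<Theta> \<Longrightarrow> fresh q \<Theta> \<Longrightarrow>
    {p, q} \<inter> (atoms \<alpha> \<union> atoms \<beta>) = {} \<Longrightarrow>
    deriv (\<Delta>\<^sub>1 \<union> \<Theta>) (\<beta>, \<sigma>)"
| dorI: "deriv \<Delta>\<^sub>1 (\<alpha>, \<phi>) \<Longrightarrow> deriv \<Delta>\<^sub>2 (\<beta>, \<psi>) \<Longrightarrow> deriv (\<Delta>\<^sub>1 \<union> \<Delta>\<^sub>2) (\<alpha> \<oplus> \<beta>, DOr \<phi> \<psi>)"
| dorE: "deriv \<Delta>\<^sub>1 (\<alpha>, DOr \<phi> \<psi>) \<Longrightarrow> deriv \<Delta>\<^sub>2 (\<beta>, \<sigma>) \<Longrightarrow>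
    \<Theta> = \<Delta>\<^sub>2 - {(Atom p, \<phi>), (Atom q, \<psi>), \<alpha> \<doteq> Atom p \<oplus> Atom q} \<Longrightarrow>
    p \<noteq> q \<Longrightarrow> fresh p \<Theta> \<Longrightarrow> fresh q \<Theta> \<Longrightarrow>
    {p, q} \<inter> (atoms \<alpha> \<union> atoms \<beta>) = {} \<Longrightarrow>
    deriv (\<Delta>\<^sub>1 \<union> \<Theta>) (\<beta>, \<sigma>)"
| dnegI: "deriv \<Delta> (\<alpha>, \<phi>) \<Longrightarrow> deriv \<Delta> (\<ominus> \<alpha>, DNeg \<phi>)"
| dnegE: "deriv \<Delta> (\<alpha>, DNeg \<phi>) \<Longrightarrow> deriv \<Delta> (\<ominus> \<alpha>, \<phi>)"

definition derivable :: "lfm set \<Rightarrow> lfm \<Rightarrow> bool" where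
  "derivable \<Gamma> x \<longleftrightarrow> (\<exists>\<Delta>\<subseteq>\<Gamma>. deriv \<Delta> x)"

end

theory Submission
  imports Defs "HOL-Library.Countable"
begin

text \<open>
  A Henkin argument. If \<open>\<alpha> : \<phi>\<close> is not derivable from \<open>\<Gamma>\<close>, then \<open>\<Gamma>\<close> with \<open>\<alpha> : Neg \<phi>\<close> is consistent and
  extends to a maximal consistent set \<open>M\<close> in which every member \<open>\<alpha> : DAnd \<phi> \<psi>\<close> or \<open>\<alpha> : DOr \<phi> \<psi>\<close> has
  witnessing atoms. Labels modulo \<open>(\<alpha> = \<beta>) \<in> M\<close> form a countable Boolean algebra, and
  \<open>\<phi> \<mapsto> {[\<alpha>]. \<alpha> : \<phi> \<in> M}\<close> is a homomorphism refuting the entailment. Since \<open>\<Gamma>\<close> may mention every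
  atom, its atoms are first moved to the even ones; a derivation is finite, so the resulting
  derivation can be moved back along an injective renaming.
\<close>

section \<open>Completeness of the classical calculus on labels\<close>

primrec val :: "(nat \<Rightarrow> bool) \<Rightarrow> lb \<Rightarrow> bool" where
  "val v (Atom p) = v p"
| "val v LZero = False"
| "val v (\<ominus> \<alpha>) = (\<not> val v \<alpha>)"
| "val v (\<alpha> \<oplus> \<beta>) = (val v \<alpha> \<or> val v \<beta>)"
| "val v (\<alpha> \<odot> \<beta>) = (val v \<alpha> \<and> val v \<beta>)"

lemma val_liff [simp]: "val v (liff \<alpha> \<beta>) \<longleftrightarrow> val v \<alpha> = val v \<beta>"
  by (auto simp: liff_def)

lemma finite_atoms [simp]: "finite (atoms \<alpha>)"
  by (induction \<alpha>) auto

lemma cpl_mono: "cpl A \<alpha> \<Longrightarrow> A \<subseteq> B \<Longrightarrow> cpl B \<alpha>"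
proof (induction arbitrary: B rule: cpl.induct)
  case (cpl_disjE A \<alpha> \<beta> \<gamma>)
  then show ?case by (meson cpl.cpl_disjE insert_mono)
next
  case (cpl_negI \<alpha> A)
  then show ?case by (meson cpl.cpl_negI insert_mono)
next
  case (cpl_raa \<alpha> A)
  then show ?case by (meson cpl.cpl_raa insert_mono)
next
  case (cpl_negE A \<alpha>)
  then show ?case by (meson cpl.cpl_negE)
next
  case (cpl_conjE1 A \<alpha> \<beta>)
  then show ?case by (meson cpl.cpl_conjE1)
next
  case (cpl_conjE2 A \<alpha> \<beta>)
  then show ?case by (meson cpl.cpl_conjE2)
qed (simp_all add: cpl_assm subsetD cpl_conjI cpl_disjI1 cpl_disjI2 cpl_botE)

lemma cpl_explode: "cpl A \<alpha> \<Longrightarrow> cpl A (\<ominus> \<alpha>) \<Longrightarrow> cpl A \<beta>"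
  by (rule cpl_botE) (rule cpl_negE)

text \<open>Excluded middle as a rule: under the assumption \<open>\<ominus> \<beta>\<close>, the
  first derivation refutes \<open>\<alpha>\<close> and the second refutes
  \<open>\<ominus> \<alpha>\<close>.\<close>

lemma cpl_cases:
  assumes "cpl (insert \<alpha> A) \<beta>" and "cpl (insert (\<ominus> \<alpha>) A) \<beta>"
  shows "cpl A \<beta>"
proof (rule cpl_raa)
  let ?A = "insert (\<ominus> \<beta>) A"
  have "cpl (insert \<alpha> ?A) \<beta>" using assms(1) by (rule cpl_mono) auto
  then have "cpl (insert \<alpha> ?A) LZero" by (rule cpl_negE) (simp add: cpl_assm)
  then have neg: "cpl ?A (\<ominus> \<alpha>)" by (rule cpl_negI)
  have "cpl (insert (\<ominus> \<alpha>) ?A) \<beta>" using assms(2) by (rule cpl_mono) auto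
  then have "cpl (insert (\<ominus> \<alpha>) ?A) LZero" by (rule cpl_negE) (simp add: cpl_assm)
  then have "cpl ?A \<alpha>" by (rule cpl_raa)
  then show "cpl ?A LZero" using neg by (rule cpl_negE)
qed

definition literal :: "(nat \<Rightarrow> bool) \<Rightarrow> nat \<Rightarrow> lb" where
  "literal v p = (if v p then Atom p else \<ominus> Atom p)"

text \<open>Kalmar's lemma: the literals true under \<open>v\<close> prove or refute each label over
  the atoms in \<open>S\<close>, by induction along the truth table.\<close>

lemma cpl_literals:
  "atoms \<alpha> \<subseteq> S \<Longrightarrow> cpl (literal v ` S) (if val v \<alpha> then \<alpha> else \<ominus> \<alpha>)"
proof (induction \<alpha>)
  case (Atom p)
  then have "literal v p \<in> literal v ` S" by auto
  then have "cpl (literal v ` S) (literal v p)" by (rule cpl_assm)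
  then show ?case by (simp add: literal_def split: if_splits)
next
  case LZero
  then show ?case by (simp add: cpl_negI cpl_assm)
next
  case (LNeg \<alpha>)
  let ?L = "literal v ` S"
  have IH: "cpl ?L (if val v \<alpha> then \<alpha> else \<ominus> \<alpha>)" using LNeg by simp
  show ?case
  proof (cases "val v \<alpha>")
    case True
    then have "cpl ?L \<alpha>" using IH by simp
    then have "cpl (insert (\<ominus> \<alpha>) ?L) \<alpha>" by (rule cpl_mono) auto
    then have "cpl (insert (\<ominus> \<alpha>) ?L) LZero" by (rule cpl_negE) (simp add: cpl_assm)
    then show ?thesis using True by (simp add: cpl_negI)
  qed (use IH in simp)
next
  case (LPlus \<alpha> \<beta>)
  let ?L = "literal v ` S"
  have IH: "cpl ?L (if val v \<alpha> then \<alpha> else \<ominus> \<alpha>)" "cpl ?L (if val v \<beta> then \<beta> else \<ominus> \<beta>)"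
    using LPlus by simp_all
  show ?case
  proof (cases "val v \<alpha> \<or> val v \<beta>")
    case True
    then show ?thesis using IH by (auto intro: cpl_disjI1 cpl_disjI2)
  next
    case False
    let ?A = "insert (\<alpha> \<oplus> \<beta>) ?L"
    have neg: "cpl ?L (\<ominus> \<alpha>)" "cpl ?L (\<ominus> \<beta>)" using False IH by auto
    have "cpl (insert \<alpha> ?A) LZero"
      by (rule cpl_negE[of _ \<alpha>]) (simp add: cpl_assm, rule cpl_mono[OF neg(1)], auto)
    moreover have "cpl (insert \<beta> ?A) LZero"
      by (rule cpl_negE[of _ \<beta>]) (simp add: cpl_assm, rule cpl_mono[OF neg(2)], auto)
    moreover have "cpl ?A (\<alpha> \<oplus> \<beta>)" by (simp add: cpl_assm)
    ultimately have "cpl ?A LZero" by (blast intro: cpl_disjE)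
    then show ?thesis using False by (simp add: cpl_negI)
  qed
next
  case (LTimes \<alpha> \<beta>)
  let ?L = "literal v ` S"
  have IH: "cpl ?L (if val v \<alpha> then \<alpha> else \<ominus> \<alpha>)" "cpl ?L (if val v \<beta> then \<beta> else \<ominus> \<beta>)"
    using LTimes by simp_all
  show ?case
  proof (cases "val v \<alpha> \<and> val v \<beta>")
    case True
    then show ?thesis using IH by (auto intro: cpl_conjI)
  next
    case False
    let ?A = "insert (\<alpha> \<odot> \<beta>) ?L"
    have "cpl ?A (\<alpha> \<odot> \<beta>)" by (simp add: cpl_assm)
    then have pos: "cpl ?A \<alpha>" "cpl ?A \<beta>" by (rule cpl_conjE1, rule cpl_conjE2)
    have "cpl ?L (\<ominus> \<alpha>) \<or> cpl ?L (\<ominus> \<beta>)" using False IH by (auto split: if_splits)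
    then have "cpl ?A (\<ominus> \<alpha>) \<or> cpl ?A (\<ominus> \<beta>)" using cpl_mono[OF _ subset_insertI] by blast
    then have "cpl ?A LZero" using pos cpl_negE by blast
    then show ?thesis using False by (auto simp: cpl_negI)
  qed
qed

text \<open>The atoms of \<open>S\<close> are eliminated one at a time. As the hypothesis covers all
  valuations, it applies to \<open>v\<close> with \<open>p\<close> set to true and to false, and
  \<open>cpl_cases\<close> merges the two derivations.\<close>

lemma cpl_discharge_literals:
  assumes "finite S" and "\<And>v. cpl (literal v ` S \<union> A) \<beta>"
  shows "cpl A \<beta>"
  using assms
proof (induction S arbitrary: A rule: finite_induct)
  case empty
  then show ?case by simp
next
  case (insert p S)
  \<comment> \<open>Since \<open>p\<close> is not in \<open>S\<close>, changing \<open>v\<close> at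
    \<open>p\<close> leaves the literals over \<open>S\<close> alone.\<close>
  have upd: "literal (v(p := b)) ` S = literal v ` S" for v b
    using insert.hyps(2) by (intro image_cong) (auto simp: literal_def)
  have lit: "literal (v(p := b)) p = (if b then Atom p else \<ominus> Atom p)" for v b
    by (simp add: literal_def)
  have "cpl (literal v ` S \<union> insert (Atom p) A) \<beta>" for v
    using insert.prems[of "v(p := True)"] by (simp only: image_insert upd lit if_True if_False Un_insert_left Un_insert_right)
  then have 1: "cpl (insert (Atom p) A) \<beta>" by (rule insert.IH)
  have "cpl (literal v ` S \<union> insert (\<ominus> Atom p) A) \<beta>" for v
    using insert.prems[of "v(p := False)"] by (simp only: image_insert upd lit if_True if_False Un_insert_left Un_insert_right)
  then have "cpl (insert (\<ominus> Atom p) A) \<beta>" by (rule insert.IH)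
  with 1 show ?case by (rule cpl_cases)
qed

text \<open>For each valuation the literals either prove \<open>\<beta>\<close> or refute some
  member of \<open>A\<close>, which makes \<open>A\<close> explosive. Finiteness of \<open>A\<close>
  leaves finitely many literals to discharge.\<close>

theorem cpl_complete:
  assumes "finite A" and sem: "\<And>v. (\<And>\<alpha>. \<alpha> \<in> A \<Longrightarrow> val v \<alpha>) \<Longrightarrow> val v \<beta>"
  shows "cpl A \<beta>"
proof (rule cpl_discharge_literals)
  let ?S = "atoms \<beta> \<union> (\<Union>\<alpha>\<in>A. atoms \<alpha>)"
  show "finite ?S" using assms(1) by auto
  fix v
  show "cpl (literal v ` ?S \<union> A) \<beta>"
  proof (cases "val v \<beta>")
    case True
    then have "cpl (literal v ` ?S) \<beta>" using cpl_literals[of \<beta> ?S v] by simp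
    then show ?thesis by (rule cpl_mono) simp
  next
    case False
    then obtain \<alpha> where \<alpha>: "\<alpha> \<in> A" "\<not> val v \<alpha>" using sem by blast
    then have "cpl (literal v ` ?S) (\<ominus> \<alpha>)" using cpl_literals[of \<alpha> ?S v] by auto
    then have "cpl (literal v ` ?S \<union> A) (\<ominus> \<alpha>)" by (rule cpl_mono) simp
    moreover have "cpl (literal v ` ?S \<union> A) \<alpha>" using \<alpha> by (simp add: cpl_assm)
    ultimately show ?thesis by (blast intro: cpl_explode)
  qed
qed

section \<open>Derivability from a set of assumptions\<close>

lemma deriv_finite: "deriv \<Delta> x \<Longrightarrow> finite \<Delta>"
  by (induction rule: deriv.induct) auto

lemma derivable_mono: "derivable \<Gamma> x \<Longrightarrow> \<Gamma> \<subseteq> \<Gamma>' \<Longrightarrow> derivable \<Gamma>' x"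
  by (auto simp: derivable_def)

lemma derivable_assm: "x \<in> \<Gamma> \<Longrightarrow> derivable \<Gamma> x"
  unfolding derivable_def by (rule exI[of _ "{x}"]) (simp add: assm)

lemma derivable_lift1:
  "derivable \<Gamma> x \<Longrightarrow> (\<And>\<Delta>. deriv \<Delta> x \<Longrightarrow> deriv \<Delta> y) \<Longrightarrow> derivable \<Gamma> y"
  by (auto simp: derivable_def)

lemma derivable_lift2:
  assumes "derivable \<Gamma> x" and "derivable \<Gamma> y"
    and "\<And>\<Delta>\<^sub>1 \<Delta>\<^sub>2. deriv \<Delta>\<^sub>1 x \<Longrightarrow> deriv \<Delta>\<^sub>2 y \<Longrightarrow> deriv (\<Delta>\<^sub>1 \<union> \<Delta>\<^sub>2) z"
  shows "derivable \<Gamma> z"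
proof -
  obtain \<Delta>\<^sub>1 \<Delta>\<^sub>2 where "\<Delta>\<^sub>1 \<subseteq> \<Gamma>" "\<Delta>\<^sub>2 \<subseteq> \<Gamma>" "deriv \<Delta>\<^sub>1 x" "deriv \<Delta>\<^sub>2 y"
    using assms(1,2) unfolding derivable_def by blast
  then have "\<Delta>\<^sub>1 \<union> \<Delta>\<^sub>2 \<subseteq> \<Gamma>" "deriv (\<Delta>\<^sub>1 \<union> \<Delta>\<^sub>2) z" using assms(3) by auto
  then show ?thesis unfolding derivable_def by blast
qed

text \<open>By completeness of \<open>cpl\<close> the side condition of \<open>taut\<close> becomes
  a truth-table check, which automation can do.\<close>

lemma derivable_taut:
  assumes "finite A" and "\<And>\<alpha>. \<alpha> \<in> A \<Longrightarrow> derivable \<Gamma> (\<alpha>, DTop)"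
    and "\<And>v. (\<And>\<alpha>. \<alpha> \<in> A \<Longrightarrow> val v \<alpha>) \<Longrightarrow> val v \<beta>"
  shows "derivable \<Gamma> (\<beta>, DTop)"
proof -
  obtain D where D: "\<And>\<alpha>. \<alpha> \<in> A \<Longrightarrow> D \<alpha> \<subseteq> \<Gamma> \<and> deriv (D \<alpha>) (\<alpha>, DTop)"
    using assms(2) unfolding derivable_def by metis
  have cpl: "cpl A \<beta>"
  proof (rule cpl_complete[OF assms(1)])
    fix v assume "\<And>\<alpha>. \<alpha> \<in> A \<Longrightarrow> val v \<alpha>"
    then show "val v \<beta>" by (rule assms(3))
  qed
  have "deriv (\<Union>\<alpha>\<in>A. D \<alpha>) (\<beta>, DTop)"
  proof (rule taut[OF assms(1) _ cpl])
    fix \<alpha> assume "\<alpha> \<in> A"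
    then show "deriv (D \<alpha>) (\<alpha>, DTop)" using D by simp
  qed
  moreover have "(\<Union>\<alpha>\<in>A. D \<alpha>) \<subseteq> \<Gamma>" using D by (simp add: UN_least)
  ultimately show ?thesis unfolding derivable_def by blast
qed

text \<open>Removing the bracketed assumptions by set difference brings the open assumptions of each
  branch back inside \<Gamma>.\<close>

lemma derivable_orE:
  assumes "derivable \<Gamma> (\<alpha>, Or \<phi> \<psi>)"
    and "derivable (insert (\<alpha>, \<phi>) \<Gamma>) x" and "derivable (insert (\<alpha>, \<psi>) \<Gamma>) x"
  shows "derivable \<Gamma> x"
proof -
  obtain \<Delta>\<^sub>1 \<Delta>\<^sub>2 \<Delta>\<^sub>3 where \<Delta>: "\<Delta>\<^sub>1 \<subseteq> \<Gamma>" "\<Delta>\<^sub>2 \<subseteq> insert (\<alpha>, \<phi>) \<Gamma>" "\<Delta>\<^sub>3 \<subseteq> insert (\<alpha>, \<psi>) \<Gamma>"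
    "deriv \<Delta>\<^sub>1 (\<alpha>, Or \<phi> \<psi>)" "deriv \<Delta>\<^sub>2 x" "deriv \<Delta>\<^sub>3 x"
    using assms unfolding derivable_def by blast
  have "deriv (\<Delta>\<^sub>1 \<union> (\<Delta>\<^sub>2 - {(\<alpha>, \<phi>)}) \<union> (\<Delta>\<^sub>3 - {(\<alpha>, \<psi>)})) x"
    using orE[OF \<Delta>(4), of \<Delta>\<^sub>2 "fst x" "snd x" \<Delta>\<^sub>3] \<Delta>(5,6) by simp
  moreover have "\<Delta>\<^sub>1 \<union> (\<Delta>\<^sub>2 - {(\<alpha>, \<phi>)}) \<union> (\<Delta>\<^sub>3 - {(\<alpha>, \<psi>)}) \<subseteq> \<Gamma>" using \<Delta> by auto
  ultimately show ?thesis unfolding derivable_def by blast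
qed

lemma derivable_negI:
  assumes "derivable (insert (\<alpha>, \<phi>) \<Gamma>) (\<beta>, Bot)"
  shows "derivable \<Gamma> (\<alpha>, Neg \<phi>)"
proof -
  obtain \<Delta> where "\<Delta> \<subseteq> insert (\<alpha>, \<phi>) \<Gamma>" "deriv \<Delta> (\<beta>, Bot)"
    using assms unfolding derivable_def by blast
  then have "\<Delta> - {(\<alpha>, \<phi>)} \<subseteq> \<Gamma>" "deriv (\<Delta> - {(\<alpha>, \<phi>)}) (\<alpha>, Neg \<phi>)" by (auto intro: negI)
  then show ?thesis unfolding derivable_def by blast
qed

lemma derivable_raa:
  assumes "derivable (insert (\<alpha>, Neg \<phi>) \<Gamma>) (\<beta>, Bot)"
  shows "derivable \<Gamma> (\<alpha>, \<phi>)"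
proof -
  obtain \<Delta> where "\<Delta> \<subseteq> insert (\<alpha>, Neg \<phi>) \<Gamma>" "deriv \<Delta> (\<beta>, Bot)"
    using assms unfolding derivable_def by blast
  then have "\<Delta> - {(\<alpha>, Neg \<phi>)} \<subseteq> \<Gamma>" "deriv (\<Delta> - {(\<alpha>, Neg \<phi>)}) (\<alpha>, \<phi>)" by (auto intro: raa)
  then show ?thesis unfolding derivable_def by blast
qed

section \<open>Consistency and fresh witnesses\<close>

definition consistent :: "lfm set \<Rightarrow> bool" where
  "consistent \<Gamma> \<longleftrightarrow> (\<forall>\<beta>. \<not> derivable \<Gamma> (\<beta>, Bot))"

text \<open>By \<open>botE\<close>, \<open>Bot\<close> at one label yields \<open>Bot\<close> at
  every label. The choice of \<open>LZero\<close> pays off in the witness lemmas: it contains no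
  atoms.\<close>

lemma consistentI: "\<not> derivable \<Gamma> (LZero, Bot) \<Longrightarrow> consistent \<Gamma>"
  unfolding consistent_def using botE derivable_lift1 by metis

text \<open>A derivation of \<open>LZero : Bot\<close> using the witnesses can be closed by
  \<open>dandE\<close>, which discharges exactly these three assumptions and leaves a contradiction
  from \<Gamma> alone. The eigenatoms avoid \<alpha> because \<alpha> occurs in \<Gamma>.\<close>

lemma consistent_dand_witness:
  assumes "consistent \<Gamma>" and mem: "(\<alpha>, DAnd \<phi> \<psi>) \<in> \<Gamma>"
    and pq: "p \<noteq> q" "fresh p \<Gamma>" "fresh q \<Gamma>"
  shows "consistent (\<Gamma> \<union> {(Atom p, \<phi>), (Atom q, \<psi>), \<alpha> \<doteq> Atom p \<odot> Atom q})"
    (is "consistent (\<Gamma> \<union> ?W)")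
proof (rule consistentI, rule notI)
  assume "derivable (\<Gamma> \<union> ?W) (LZero, Bot)"
  then obtain \<Delta> where \<Delta>: "\<Delta> - ?W \<subseteq> \<Gamma>" "deriv \<Delta> (LZero, Bot)"
    unfolding derivable_def by blast
  have "fresh p (\<Delta> - ?W)" "fresh q (\<Delta> - ?W)" using \<Delta>(1) pq unfolding fresh_def by blast+
  moreover have "{p, q} \<inter> (atoms \<alpha> \<union> atoms LZero) = {}" using mem pq unfolding fresh_def by auto
  ultimately have "deriv ({(\<alpha>, DAnd \<phi> \<psi>)} \<union> (\<Delta> - ?W)) (LZero, Bot)"
    using dandE[OF assm \<Delta>(2) refl] pq(1) by blast
  moreover have "{(\<alpha>, DAnd \<phi> \<psi>)} \<union> (\<Delta> - ?W) \<subseteq> \<Gamma>" using \<Delta>(1) mem by blast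
  ultimately show False using assms(1) unfolding consistent_def derivable_def by blast
qed

text \<open>The same argument, with \<open>dorE\<close> discharging the three witnessing
  assumptions.\<close>

lemma consistent_dor_witness:
  assumes "consistent \<Gamma>" and mem: "(\<alpha>, DOr \<phi> \<psi>) \<in> \<Gamma>"
    and pq: "p \<noteq> q" "fresh p \<Gamma>" "fresh q \<Gamma>"
  shows "consistent (\<Gamma> \<union> {(Atom p, \<phi>), (Atom q, \<psi>), \<alpha> \<doteq> Atom p \<oplus> Atom q})"
    (is "consistent (\<Gamma> \<union> ?W)")
proof (rule consistentI, rule notI)
  assume "derivable (\<Gamma> \<union> ?W) (LZero, Bot)"
  then obtain \<Delta> where \<Delta>: "\<Delta> - ?W \<subseteq> \<Gamma>" "deriv \<Delta> (LZero, Bot)"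
    unfolding derivable_def by blast
  have "fresh p (\<Delta> - ?W)" "fresh q (\<Delta> - ?W)" using \<Delta>(1) pq unfolding fresh_def by blast+
  moreover have "{p, q} \<inter> (atoms \<alpha> \<union> atoms LZero) = {}" using mem pq unfolding fresh_def by auto
  ultimately have "deriv ({(\<alpha>, DOr \<phi> \<psi>)} \<union> (\<Delta> - ?W)) (LZero, Bot)"
    using dorE[OF assm \<Delta>(2) refl] pq(1) by blast
  moreover have "{(\<alpha>, DOr \<phi> \<psi>)} \<union> (\<Delta> - ?W) \<subseteq> \<Gamma>" using \<Delta>(1) mem by blast
  ultimately show False using assms(1) unfolding consistent_def derivable_def by blast
qed

section \<open>Renaming atoms\<close>

primrec ren :: "(nat \<Rightarrow> nat) \<Rightarrow> lb \<Rightarrow> lb" where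
  "ren f (Atom p) = Atom (f p)"
| "ren f LZero = LZero"
| "ren f (\<ominus> \<alpha>) = \<ominus> ren f \<alpha>"
| "ren f (\<alpha> \<oplus> \<beta>) = ren f \<alpha> \<oplus> ren f \<beta>"
| "ren f (\<alpha> \<odot> \<beta>) = ren f \<alpha> \<odot> ren f \<beta>"

abbreviation ren_lfm :: "(nat \<Rightarrow> nat) \<Rightarrow> lfm \<Rightarrow> lfm" where
  "ren_lfm f \<equiv> apfst (ren f)"

lemma ren_ren: "ren f (ren g \<alpha>) = ren (f \<circ> g) \<alpha>"
  by (induction \<alpha>) auto

lemma ren_eq_self: "(\<And>p. p \<in> atoms \<alpha> \<Longrightarrow> f p = p) \<Longrightarrow> ren f \<alpha> = \<alpha>"
  by (induction \<alpha>) auto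

lemma atoms_ren: "atoms (ren f \<alpha>) = f ` atoms \<alpha>"
  by (induction \<alpha>) auto

lemma inj_ren:
  assumes "inj f" shows "inj (ren f)"
proof (rule inj_on_inverseI)
  fix \<alpha>
  show "ren (inv f) (ren f \<alpha>) = \<alpha>" using assms by (simp add: ren_ren ren_eq_self)
qed

lemma inj_ren_lfm: "inj f \<Longrightarrow> inj (ren_lfm f)"
  using inj_ren[of f] by (simp add: inj_apfst)

lemma ren_leq: "ren_lfm f (\<alpha> \<doteq> \<beta>) = (ren f \<alpha> \<doteq> ren f \<beta>)"
  by (simp add: leq_def liff_def)

lemma fresh_ren: "inj f \<Longrightarrow> fresh (f p) (ren_lfm f ` \<Delta>) \<longleftrightarrow> fresh p \<Delta>"
  by (auto simp: fresh_def atoms_ren inj_image_mem_iff case_prod_beta)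

lemma cpl_ren: "cpl A \<alpha> \<Longrightarrow> cpl (ren f ` A) (ren f \<alpha>)"
proof (induction rule: cpl.induct)
  case (cpl_disjE A \<alpha> \<beta> \<gamma>)
  then show ?case by simp (erule (2) cpl.cpl_disjE)
next
  case (cpl_negE A \<alpha>)
  then show ?case by simp (erule (1) cpl.cpl_negE)
next
  case (cpl_conjE1 A \<alpha> \<beta>)
  then show ?case by simp (erule cpl.cpl_conjE1)
next
  case (cpl_conjE2 A \<alpha> \<beta>)
  then show ?case by simp (erule cpl.cpl_conjE2)
next
  case (cpl_botE A \<alpha>)
  then show ?case by simp (erule cpl.cpl_botE)
next
  case (cpl_raa \<alpha> A)
  then show ?case by simp (erule cpl.cpl_raa)
qed (simp_all add: cpl_assm cpl_conjI cpl_disjI1 cpl_disjI2 cpl_negI)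

text \<open>Injectivity is what lets renaming commute with the set differences that model discharge
  and preserve the freshness conditions.\<close>

lemma deriv_ren:
  assumes "inj f"
  shows "deriv \<Delta> x \<Longrightarrow> deriv (ren_lfm f ` \<Delta>) (ren_lfm f x)"
proof (induction rule: deriv.induct)
  case (taut A D \<beta>)
  \<comment> \<open>\<open>D\<close> is indexed by the original premises, so a renamed premise is
    pulled back before its assumption set is looked up.\<close>
  let ?D = "\<lambda>\<beta>. ren_lfm f ` D (inv (ren f) \<beta>)"
  have "deriv (?D \<gamma>) (\<gamma>, DTop)" if "\<gamma> \<in> ren f ` A" for \<gamma>
    using that taut.IH by (auto simp: inv_f_f[OF inj_ren[OF assms]])
  then have "deriv (\<Union>\<gamma>\<in>ren f ` A. ?D \<gamma>) (ren f \<beta>, DTop)"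
    using taut.hyps by (intro deriv.taut finite_imageI cpl_ren)
  then show ?case by (simp add: image_UN inv_f_f[OF inj_ren[OF assms]])
next
  case sub
  then show ?case
    by (simp add: image_Un image_set_diff[OF inj_ren_lfm[OF assms]] ren_leq) (erule (1) deriv.sub)
next
  case orE
  then show ?case
    by (simp add: image_Un image_set_diff[OF inj_ren_lfm[OF assms]] ren_leq) (erule (2) deriv.orE)
next
  case negI
  then show ?case
    by (simp add: image_Un image_set_diff[OF inj_ren_lfm[OF assms]] ren_leq) (erule deriv.negI)
next
  case raa
  then show ?case
    by (simp add: image_Un image_set_diff[OF inj_ren_lfm[OF assms]] ren_leq) (erule deriv.raa)
next
  case andI
  then show ?case
    by (simp add: image_Un image_set_diff[OF inj_ren_lfm[OF assms]] ren_leq) (erule (1) deriv.andI)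
next
  case andE1
  then show ?case
    by (simp add: image_Un image_set_diff[OF inj_ren_lfm[OF assms]] ren_leq) (erule deriv.andE1)
next
  case andE2
  then show ?case
    by (simp add: image_Un image_set_diff[OF inj_ren_lfm[OF assms]] ren_leq) (erule deriv.andE2)
next
  case orI1
  then show ?case
    by (simp add: image_Un image_set_diff[OF inj_ren_lfm[OF assms]] ren_leq) (erule deriv.orI1)
next
  case orI2
  then show ?case
    by (simp add: image_Un image_set_diff[OF inj_ren_lfm[OF assms]] ren_leq) (erule deriv.orI2)
next
  case negE
  then show ?case
    by (simp add: image_Un image_set_diff[OF inj_ren_lfm[OF assms]] ren_leq) (erule (1) deriv.negE)
next
  case botE
  then show ?case
    by (simp add: image_Un image_set_diff[OF inj_ren_lfm[OF assms]] ren_leq) (erule deriv.botE)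
next
  case dandI
  then show ?case
    by (simp add: image_Un image_set_diff[OF inj_ren_lfm[OF assms]] ren_leq) (erule (1) deriv.dandI)
next
  case dorI
  then show ?case
    by (simp add: image_Un image_set_diff[OF inj_ren_lfm[OF assms]] ren_leq) (erule (1) deriv.dorI)
next
  case dnegI
  then show ?case
    by (simp add: image_Un image_set_diff[OF inj_ren_lfm[OF assms]] ren_leq) (erule deriv.dnegI)
next
  case dnegE
  then show ?case
    by (simp add: image_Un image_set_diff[OF inj_ren_lfm[OF assms]] ren_leq) (erule deriv.dnegE)
next
  case (dandE \<Delta>\<^sub>1 \<alpha> \<phi> \<psi> \<Delta>\<^sub>2 \<beta> \<sigma> \<Theta> p q)
  have "deriv (ren_lfm f ` \<Delta>\<^sub>1 \<union> ren_lfm f ` \<Theta>) (ren f \<beta>, \<sigma>)"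
  \<comment> \<open>The eigenatoms are renamed along with everything else.\<close>
  proof (rule deriv.dandE[where p = "f p" and q = "f q"])
    show "deriv (ren_lfm f ` \<Delta>\<^sub>1) (ren f \<alpha>, DAnd \<phi> \<psi>)" "deriv (ren_lfm f ` \<Delta>\<^sub>2) (ren f \<beta>, \<sigma>)"
      using dandE.IH by auto
    show "ren_lfm f ` \<Theta> = ren_lfm f ` \<Delta>\<^sub>2
        - {(Atom (f p), \<phi>), (Atom (f q), \<psi>), ren f \<alpha> \<doteq> Atom (f p) \<odot> Atom (f q)}"
      using dandE.hyps(3) by (simp add: image_set_diff[OF inj_ren_lfm[OF assms]] ren_leq)
    show "f p \<noteq> f q" using dandE.hyps(4) assms by (auto dest: injD)
    show "fresh (f p) (ren_lfm f ` \<Theta>)" "fresh (f q) (ren_lfm f ` \<Theta>)"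
      using dandE.hyps(5,6) by (simp_all add: fresh_ren[OF assms])
    show "{f p, f q} \<inter> (atoms (ren f \<alpha>) \<union> atoms (ren f \<beta>)) = {}"
      using dandE.hyps(7) assms by (auto simp: atoms_ren inj_image_mem_iff)
  qed
  then show ?case by (simp add: image_Un)
next
  case (dorE \<Delta>\<^sub>1 \<alpha> \<phi> \<psi> \<Delta>\<^sub>2 \<beta> \<sigma> \<Theta> p q)
  have "deriv (ren_lfm f ` \<Delta>\<^sub>1 \<union> ren_lfm f ` \<Theta>) (ren f \<beta>, \<sigma>)"
  proof (rule deriv.dorE[where p = "f p" and q = "f q"])
    show "deriv (ren_lfm f ` \<Delta>\<^sub>1) (ren f \<alpha>, DOr \<phi> \<psi>)" "deriv (ren_lfm f ` \<Delta>\<^sub>2) (ren f \<beta>, \<sigma>)"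
      using dorE.IH by auto
    show "ren_lfm f ` \<Theta> = ren_lfm f ` \<Delta>\<^sub>2
        - {(Atom (f p), \<phi>), (Atom (f q), \<psi>), ren f \<alpha> \<doteq> Atom (f p) \<oplus> Atom (f q)}"
      using dorE.hyps(3) by (simp add: image_set_diff[OF inj_ren_lfm[OF assms]] ren_leq)
    show "f p \<noteq> f q" using dorE.hyps(4) assms by (auto dest: injD)
    show "fresh (f p) (ren_lfm f ` \<Theta>)" "fresh (f q) (ren_lfm f ` \<Theta>)"
      using dorE.hyps(5,6) by (simp_all add: fresh_ren[OF assms])
    show "{f p, f q} \<inter> (atoms (ren f \<alpha>) \<union> atoms (ren f \<beta>)) = {}"
      using dorE.hyps(7) assms by (auto simp: atoms_ren inj_image_mem_iff)
  qed
  then show ?case by (simp add: image_Un)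
qed (simp add: deriv.assm)

text \<open>\<open>deriv_ren\<close> asks for an injection on all atoms, whereas halving every even
  number would leave no values for the odd ones. Halving only the doubles of elements of
  \<open>F\<close> keeps those values below \<open>N\<close>; all other numbers are shifted to
  \<open>N\<close> or above.\<close>

lemma extend_halving_inj:
  assumes "finite F"
  shows "\<exists>f :: nat \<Rightarrow> nat. inj f \<and> (\<forall>p\<in>F. f (2 * p) = p)"
proof -
  \<comment> \<open>The inserted 0 makes \<open>Max\<close> meaningful when \<open>F\<close> is
    empty.\<close>
  define N where "N = Suc (Max (insert 0 F))"
  have N: "p < N" if "p \<in> F" for p
    using assms that unfolding N_def by (simp add: le_imp_less_Suc)
  define f where "f n = (if even n \<and> n div 2 \<in> F then n div 2 else n + N)" for n
  have "inj f"
  proof (rule injI)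
    fix m n assume "f m = f n"
    then show "m = n" using N[of "m div 2"] N[of "n div 2"]
      by (auto simp: f_def elim!: evenE split: if_splits)
  qed
  moreover have "\<forall>p\<in>F. f (2 * p) = p" by (simp add: f_def)
  ultimately show ?thesis by blast
qed

text \<open>Only the finitely many atoms in the open assumptions and the conclusion must be halved
  back; atoms occurring solely inside the derivation may land anywhere, provided the renaming is
  injective.\<close>

lemma derivable_unshift:
  assumes "derivable (ren_lfm ((*) 2) ` \<Gamma>) (ren_lfm ((*) 2) x)"
  shows "derivable \<Gamma> x"
proof -
  let ?d = "(*) 2 :: nat \<Rightarrow> nat"
  obtain \<Delta>' where \<Delta>': "\<Delta>' \<subseteq> ren_lfm ?d ` \<Gamma>" "deriv \<Delta>' (ren_lfm ?d x)"
    using assms unfolding derivable_def by blast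
  from \<Delta>'(1) obtain \<Delta> where \<Delta>: "\<Delta> \<subseteq> \<Gamma>" "\<Delta>' = ren_lfm ?d ` \<Delta>"
    by (rule subset_imageE)
  have "inj (ren_lfm ?d)" by (rule inj_ren_lfm) (simp add: inj_def)
  then have "inj_on (ren_lfm ?d) \<Delta>" by (rule inj_on_subset) simp
  then have fin: "finite \<Delta>"
    using deriv_finite[OF \<Delta>'(2)] unfolding \<Delta>(2) by (rule finite_imageD[rotated])
  define F where "F = (\<Union>y\<in>insert x \<Delta>. atoms (fst y))"
  have "finite F" using fin unfolding F_def by auto
  from extend_halving_inj[OF this] obtain f where f: "inj f" "\<forall>p\<in>F. f (2 * p) = p"
    by (elim exE conjE)
  have undo: "ren_lfm f (ren_lfm ?d y) = y" if "y \<in> insert x \<Delta>" for y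
  proof -
    have "ren (f \<circ> ?d) (fst y) = fst y"
    proof (rule ren_eq_self)
      fix p assume "p \<in> atoms (fst y)"
      then have "p \<in> F" using that unfolding F_def by blast
      then show "(f \<circ> ?d) p = p" using f(2) by simp
    qed
    then show ?thesis by (cases y) (simp add: ren_ren)
  qed
  have "ren_lfm f ` \<Delta>' = (\<lambda>y. y) ` \<Delta>"
    unfolding \<Delta>(2) image_image by (rule image_cong) (simp_all only: undo insertI2)
  then have "ren_lfm f ` \<Delta>' = \<Delta>" by simp
  then have "deriv \<Delta> x" using deriv_ren[OF f(1) \<Delta>'(2)] undo[of x] by simp
  then show ?thesis using \<Delta>(1) unfolding derivable_def by blast
qed

text \<open>A model of the renamed set becomes a model of \<Gamma> when its label homomorphism is
  precomposed with \<open>ren f\<close>; the formula homomorphism stays the same.\<close>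

lemma entails_ren:
  assumes "entails TYPE('b) \<Gamma> x"
  shows "entails TYPE('b) (ren_lfm f ` \<Gamma>) (ren_lfm f x)"
  unfolding entails_def
proof (intro allI impI)
  fix B :: "'b ba" and h H
  assume hyps: "boolean_alg B" "lb_hom B h" "fm_hom B H"
    and sat: "\<forall>(\<alpha>, \<phi>) \<in> ren_lfm f ` \<Gamma>. h \<alpha> \<in> H \<phi>"
  have "lb_hom B (h \<circ> ren f)" using hyps(2) unfolding lb_hom_def by auto
  moreover have "\<forall>(\<alpha>, \<phi>) \<in> \<Gamma>. (h \<circ> ren f) \<alpha> \<in> H \<phi>" using sat by force
  ultimately have "(h \<circ> ren f) (fst x) \<in> H (snd x)"
    using assms hyps unfolding entails_def by blast
  then show "h (fst (ren_lfm f x)) \<in> H (snd (ren_lfm f x))" by simp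
qed

section \<open>Henkin sets and their quotient algebras\<close>

text \<open>The witnesses are arbitrary labels here, since only their classes in the quotient
  matter.\<close>

locale henkin_set =
  fixes M :: "lfm set"
  assumes closed: "derivable M x \<Longrightarrow> x \<in> M"
    and Bot_notin: "(\<alpha>, Bot) \<notin> M"
    and complete: "(\<alpha>, \<phi>) \<in> M \<or> (\<alpha>, Neg \<phi>) \<in> M"
    and dand_witness: "(\<alpha>, DAnd \<phi> \<psi>) \<in> M \<Longrightarrow>
      \<exists>\<beta> \<gamma>. (\<beta>, \<phi>) \<in> M \<and> (\<gamma>, \<psi>) \<in> M \<and> (\<alpha> \<doteq> \<beta> \<odot> \<gamma>) \<in> M"
    and dor_witness: "(\<alpha>, DOr \<phi> \<psi>) \<in> M \<Longrightarrow>
      \<exists>\<beta> \<gamma>. (\<beta>, \<phi>) \<in> M \<and> (\<gamma>, \<psi>) \<in> M \<and> (\<alpha> \<doteq> \<beta> \<oplus> \<gamma>) \<in> M"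
begin

lemma closed1:
  assumes "x \<in> M" and "\<And>\<Delta>. deriv \<Delta> x \<Longrightarrow> deriv \<Delta> y"
  shows "y \<in> M"
  by (rule closed, rule derivable_lift1[OF derivable_assm[OF assms(1)]]) (rule assms(2))

lemma closed2:
  assumes "x \<in> M" and "y \<in> M"
    and "\<And>\<Delta>\<^sub>1 \<Delta>\<^sub>2. deriv \<Delta>\<^sub>1 x \<Longrightarrow> deriv \<Delta>\<^sub>2 y \<Longrightarrow> deriv (\<Delta>\<^sub>1 \<union> \<Delta>\<^sub>2) z"
  shows "z \<in> M"
  by (rule closed, rule derivable_lift2[OF derivable_assm[OF assms(1)] derivable_assm[OF assms(2)]])
    (rule assms(3))

lemma taut_closed:
  assumes "finite A" and "\<And>\<alpha>. \<alpha> \<in> A \<Longrightarrow> (\<alpha>, DTop) \<in> M"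
    and "\<And>v. (\<And>\<alpha>. \<alpha> \<in> A \<Longrightarrow> val v \<alpha>) \<Longrightarrow> val v \<beta>"
  shows "(\<beta>, DTop) \<in> M"
proof (rule closed, rule derivable_taut[OF assms(1)])
  fix \<alpha> assume "\<alpha> \<in> A"
  then show "derivable M (\<alpha>, DTop)" by (intro derivable_assm assms(2))
next
  fix v assume "\<And>\<alpha>. \<alpha> \<in> A \<Longrightarrow> val v \<alpha>"
  then show "val v \<beta>" by (rule assms(3))
qed

lemma taut_closed1:
  assumes "(\<alpha>, DTop) \<in> M" and "\<And>v. val v \<alpha> \<Longrightarrow> val v \<beta>"
  shows "(\<beta>, DTop) \<in> M"
  by (rule taut_closed[of "{\<alpha>}"]) (use assms in auto)

lemma taut_closed2:
  assumes "(\<alpha>, DTop) \<in> M" and "(\<beta>, DTop) \<in> M"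
    and "\<And>v. val v \<alpha> \<Longrightarrow> val v \<beta> \<Longrightarrow> val v \<gamma>"
  shows "(\<gamma>, DTop) \<in> M"
  by (rule taut_closed[of "{\<alpha>, \<beta>}"]) (use assms in auto)

lemma leq_taut: "(\<And>v. val v \<alpha> = val v \<beta>) \<Longrightarrow> (\<alpha> \<doteq> \<beta>) \<in> M"
  unfolding leq_def by (rule taut_closed[of "{}"]) auto

text \<open>This law and the four after it make provable equality a congruence; each is a classical
  consequence between biconditionals, hence an instance of \<open>taut\<close>.\<close>

lemma leq_sym: "(\<alpha> \<doteq> \<beta>) \<in> M \<Longrightarrow> (\<beta> \<doteq> \<alpha>) \<in> M"
  unfolding leq_def by (erule taut_closed1) auto

lemma leq_trans: "(\<alpha> \<doteq> \<beta>) \<in> M \<Longrightarrow> (\<beta> \<doteq> \<gamma>) \<in> M \<Longrightarrow> (\<alpha> \<doteq> \<gamma>) \<in> M"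
  unfolding leq_def by (erule taut_closed2) auto

lemma leq_neg: "(\<alpha> \<doteq> \<beta>) \<in> M \<Longrightarrow> (\<ominus> \<alpha> \<doteq> \<ominus> \<beta>) \<in> M"
  unfolding leq_def by (erule taut_closed1) auto

lemma leq_plus: "(\<alpha> \<doteq> \<beta>) \<in> M \<Longrightarrow> (\<gamma> \<doteq> \<delta>) \<in> M \<Longrightarrow> (\<alpha> \<oplus> \<gamma> \<doteq> \<beta> \<oplus> \<delta>) \<in> M"
  unfolding leq_def by (erule taut_closed2) auto

lemma leq_times: "(\<alpha> \<doteq> \<beta>) \<in> M \<Longrightarrow> (\<gamma> \<doteq> \<delta>) \<in> M \<Longrightarrow> (\<alpha> \<odot> \<gamma> \<doteq> \<beta> \<odot> \<delta>) \<in> M"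
  unfolding leq_def by (erule taut_closed2) auto

lemma subst: "(\<alpha> \<doteq> \<beta>) \<in> M \<Longrightarrow> (\<alpha>, \<phi>) \<in> M \<Longrightarrow> (\<beta>, \<phi>) \<in> M"
  using closed2[OF _ _ sub] .

lemma Neg_iff: "(\<alpha>, Neg \<phi>) \<in> M \<longleftrightarrow> (\<alpha>, \<phi>) \<notin> M"
proof
  assume neg: "(\<alpha>, Neg \<phi>) \<in> M"
  show "(\<alpha>, \<phi>) \<notin> M"
  proof
    assume "(\<alpha>, \<phi>) \<in> M"
    then have "(\<alpha>, Bot) \<in> M" using neg by (rule closed2[OF _ _ negE])
    then show False by (simp add: Bot_notin)
  qed
qed (use complete in blast)

lemma And_iff: "(\<alpha>, And \<phi> \<psi>) \<in> M \<longleftrightarrow> (\<alpha>, \<phi>) \<in> M \<and> (\<alpha>, \<psi>) \<in> M"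
proof
  assume and_mem: "(\<alpha>, And \<phi> \<psi>) \<in> M"
  show "(\<alpha>, \<phi>) \<in> M \<and> (\<alpha>, \<psi>) \<in> M"
    using closed1[OF and_mem andE1] closed1[OF and_mem andE2] by simp
next
  assume "(\<alpha>, \<phi>) \<in> M \<and> (\<alpha>, \<psi>) \<in> M"
  then show "(\<alpha>, And \<phi> \<psi>) \<in> M" by (intro closed2[OF _ _ andI]) simp_all
qed

text \<open>If neither disjunct is in \<open>M\<close>, both negations are, so both branches of
  \<open>orE\<close> end in \<open>Bot\<close>, contradicting \<open>Bot_notin\<close>.\<close>

lemma Or_iff: "(\<alpha>, Or \<phi> \<psi>) \<in> M \<longleftrightarrow> (\<alpha>, \<phi>) \<in> M \<or> (\<alpha>, \<psi>) \<in> M"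
proof
  assume or: "(\<alpha>, Or \<phi> \<psi>) \<in> M"
  show "(\<alpha>, \<phi>) \<in> M \<or> (\<alpha>, \<psi>) \<in> M"
  proof (rule ccontr)
    assume "\<not> ?thesis"
    then have neg: "(\<alpha>, Neg \<phi>) \<in> M" "(\<alpha>, Neg \<psi>) \<in> M" by (simp_all add: Neg_iff)
    have bot: "derivable (insert (\<alpha>, \<chi>) M) (\<alpha>, Bot)" if "(\<alpha>, Neg \<chi>) \<in> M" for \<chi>
      using that by (intro derivable_lift2[OF _ _ negE[where \<alpha> = \<alpha> and \<phi> = \<chi>]] derivable_assm) simp_all
    have "derivable M (\<alpha>, Bot)"
      using derivable_orE[OF derivable_assm[OF or]] bot neg by blast
    then show False using closed Bot_notin by blast
  qed
next
  assume "(\<alpha>, \<phi>) \<in> M \<or> (\<alpha>, \<psi>) \<in> M"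
  then show "(\<alpha>, Or \<phi> \<psi>) \<in> M" 
    using closed1[OF _ orI1] closed1[OF _ orI2] by blast
qed

text \<open>\<open>dnegE\<close> returns the doubly negated label, which \<open>sub\<close> replaces
  by \<alpha> through a tautological equality.\<close>

lemma DNeg_iff: "(\<ominus> \<alpha>, DNeg \<phi>) \<in> M \<longleftrightarrow> (\<alpha>, \<phi>) \<in> M"
proof
  assume "(\<ominus> \<alpha>, DNeg \<phi>) \<in> M"
  then have "(\<ominus> (\<ominus> \<alpha>), \<phi>) \<in> M" by (rule closed1[OF _ dnegE])
  moreover have "(\<ominus> (\<ominus> \<alpha>) \<doteq> \<alpha>) \<in> M" by (rule leq_taut) simp
  ultimately show "(\<alpha>, \<phi>) \<in> M" by (blast intro: subst)
next
  assume "(\<alpha>, \<phi>) \<in> M"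
  then show "(\<ominus> \<alpha>, DNeg \<phi>) \<in> M" by (rule closed1[OF _ dnegI])
qed

text \<open>\<open>DTop\<close> is \<open>DNeg DBot\<close>, so \<alpha> satisfies
  \<open>DBot\<close> exactly when \<open>\<ominus> \<alpha>\<close> satisfies \<open>DTop\<close>,
  and \<open>\<ominus> \<alpha>\<close> is classically equivalent to the biconditional of \<alpha>
  and \<open>LZero\<close>.\<close>

lemma DBot_iff: "(\<alpha>, DBot) \<in> M \<longleftrightarrow> (\<alpha> \<doteq> LZero) \<in> M"
proof -
  have "(\<alpha>, DBot) \<in> M \<longleftrightarrow> (\<ominus> \<alpha>, DTop) \<in> M" by (simp add: DTop_def DNeg_iff)
  also have "\<dots> \<longleftrightarrow> (\<alpha> \<doteq> LZero) \<in> M"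
    unfolding leq_def by (intro iffI) (erule taut_closed1; simp)+
  finally show ?thesis .
qed

end

text \<open>The quotient of the labels by the kernel of \<open>k\<close>, realised on the range of
  \<open>k\<close> so that its carrier lies in \<open>'b\<close>. The operations act on
  representatives picked by \<open>inv k\<close>.\<close>

definition quot_alg :: "(lb \<Rightarrow> 'b) \<Rightarrow> 'b ba" where
  "quot_alg k = \<lparr>carr = range k, zero = k LZero, one = k (\<ominus> LZero),
     compl = \<lambda>x. k (\<ominus> inv k x),
     join = \<lambda>x y. k (inv k x \<oplus> inv k y),
     meet = \<lambda>x y. k (inv k x \<odot> inv k y)\<rparr>"

locale henkin_quotient = henkin_set +
  fixes k :: "lb \<Rightarrow> 'b"
  assumes k_eq: "k \<alpha> = k \<beta> \<longleftrightarrow> (\<alpha> \<doteq> \<beta>) \<in> M"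
begin

lemma leq_inv_k: "(inv k (k \<alpha>) \<doteq> \<alpha>) \<in> M"
  by (simp add: f_inv_into_f flip: k_eq)

text \<open>Well-definedness: by the congruence laws the representative chosen by
  \<open>inv k\<close> does not affect the resulting class.\<close>

lemma quot_alg_simps [simp]:
  "carr (quot_alg k) = range k"
  "zero (quot_alg k) = k LZero"
  "one (quot_alg k) = k (\<ominus> LZero)"
  "compl (quot_alg k) (k \<alpha>) = k (\<ominus> \<alpha>)"
  "join (quot_alg k) (k \<alpha>) (k \<beta>) = k (\<alpha> \<oplus> \<beta>)"
  "meet (quot_alg k) (k \<alpha>) (k \<beta>) = k (\<alpha> \<odot> \<beta>)"
  by (simp_all add: quot_alg_def) (simp_all add: k_eq leq_neg leq_plus leq_times leq_inv_k)

lemma k_taut: "(\<And>v. val v \<alpha> = val v \<beta>) \<Longrightarrow> k \<alpha> = k \<beta>"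
  by (simp add: k_eq leq_taut)

text \<open>Each axiom reduces to an equation between labels that agree under every
  valuation.\<close>

lemma boolean_alg_quot: "boolean_alg (quot_alg k)"
  unfolding boolean_alg_def by (auto intro!: k_taut)

lemma lb_hom_quot: "lb_hom (quot_alg k) k"
  unfolding lb_hom_def by auto

definition truth :: "fm \<Rightarrow> 'b set" where
  "truth \<phi> = {k \<alpha> |\<alpha>. (\<alpha>, \<phi>) \<in> M}"

text \<open>By \<open>sub\<close>, membership in \<open>M\<close> depends only on the class of the
  label.\<close>

lemma k_in_truth [simp]: "k \<alpha> \<in> truth \<phi> \<longleftrightarrow> (\<alpha>, \<phi>) \<in> M"
proof
  assume "k \<alpha> \<in> truth \<phi>"
  then obtain \<beta> where "(\<alpha> \<doteq> \<beta>) \<in> M" "(\<beta>, \<phi>) \<in> M" unfolding truth_def by (auto simp: k_eq)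
  then show "(\<alpha>, \<phi>) \<in> M" by (blast intro: subst leq_sym)
qed (auto simp: truth_def)

lemma truthE: "x \<in> truth \<phi> \<Longrightarrow> (\<And>\<alpha>. x = k \<alpha> \<Longrightarrow> (\<alpha>, \<phi>) \<in> M \<Longrightarrow> P) \<Longrightarrow> P"
  unfolding truth_def by auto

lemma truth_eqI:
  assumes "X \<subseteq> range k" and "\<And>\<alpha>. (\<alpha>, \<phi>) \<in> M \<longleftrightarrow> k \<alpha> \<in> X"
  shows "truth \<phi> = X"
  using assms by (auto elim: truthE)

text \<open>The truth lemma. For \<open>DOr\<close> and \<open>DAnd\<close>, one inclusion comes
  from the witnesses in \<open>M\<close>, the other from the introduction rules.\<close>

lemma fm_hom_truth: "fm_hom (quot_alg k) truth"
  unfolding fm_hom_def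
proof (intro conjI allI)
  let ?B = "quot_alg k"
  show "range truth \<subseteq> Pow (carr ?B)" by (auto elim: truthE)
  show "truth Bot = {}" by (rule truth_eqI) (auto simp: Bot_notin)
  show "truth DBot = {zero ?B}" by (rule truth_eqI) (auto simp: k_eq DBot_iff)
  fix \<phi>
  show "truth (Neg \<phi>) = carr ?B - truth \<phi>" by (rule truth_eqI) (auto simp: Neg_iff)
  show "truth (DNeg \<phi>) = {compl ?B a |a. a \<in> truth \<phi>}"
  proof (rule truth_eqI)
    fix \<alpha>
    \<comment> \<open>This exhibits the class of \<alpha> as the complement of the class of
      \<open>\<ominus> \<alpha>\<close>, the element to which \<open>dnegE\<close> applies.\<close>
    have dn: "k (\<ominus> (\<ominus> \<alpha>)) = k \<alpha>" by (rule k_taut) simp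
    show "(\<alpha>, DNeg \<phi>) \<in> M \<longleftrightarrow> k \<alpha> \<in> {compl ?B a |a. a \<in> truth \<phi>}"
    proof
      assume "(\<alpha>, DNeg \<phi>) \<in> M"
      then have "(\<ominus> \<alpha>, \<phi>) \<in> M" by (rule closed1[OF _ dnegE])
      then have "k (\<ominus> \<alpha>) \<in> truth \<phi>" "k \<alpha> = compl ?B (k (\<ominus> \<alpha>))" by (simp_all add: dn)
      then show "k \<alpha> \<in> {compl ?B a |a. a \<in> truth \<phi>}" by blast
    next
      assume "k \<alpha> \<in> {compl ?B a |a. a \<in> truth \<phi>}"
      then obtain \<beta> where "k \<alpha> = k (\<ominus> \<beta>)" "(\<beta>, \<phi>) \<in> M" by (auto elim: truthE)
      then show "(\<alpha>, DNeg \<phi>) \<in> M" by (metis DNeg_iff k_in_truth)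
    qed
  qed (auto elim: truthE)
  fix \<psi>
  show "truth (Or \<phi> \<psi>) = truth \<phi> \<union> truth \<psi>"
    by (rule truth_eqI) (auto simp: Or_iff elim: truthE)
  show "truth (And \<phi> \<psi>) = truth \<phi> \<inter> truth \<psi>"
    by (rule truth_eqI) (auto simp: And_iff elim: truthE)
  show "truth (DOr \<phi> \<psi>) = {join ?B a b |a b. a \<in> truth \<phi> \<and> b \<in> truth \<psi>}"
  proof (rule truth_eqI)
    fix \<alpha>
    show "(\<alpha>, DOr \<phi> \<psi>) \<in> M \<longleftrightarrow> k \<alpha> \<in> {join ?B a b |a b. a \<in> truth \<phi> \<and> b \<in> truth \<psi>}"
    proof
      assume "(\<alpha>, DOr \<phi> \<psi>) \<in> M"
      then obtain \<beta> \<gamma> where "(\<beta>, \<phi>) \<in> M" "(\<gamma>, \<psi>) \<in> M" "(\<alpha> \<doteq> \<beta> \<oplus> \<gamma>) \<in> M"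
        using dor_witness by blast
      then have "k \<beta> \<in> truth \<phi>" "k \<gamma> \<in> truth \<psi>" "k \<alpha> = join ?B (k \<beta>) (k \<gamma>)"
        by (simp_all add: k_eq)
      then show "k \<alpha> \<in> {join ?B a b |a b. a \<in> truth \<phi> \<and> b \<in> truth \<psi>}" by blast
    next
      assume "k \<alpha> \<in> {join ?B a b |a b. a \<in> truth \<phi> \<and> b \<in> truth \<psi>}"
      then obtain \<beta> \<gamma> where *: "k \<alpha> = k (\<beta> \<oplus> \<gamma>)" "(\<beta>, \<phi>) \<in> M" "(\<gamma>, \<psi>) \<in> M"
        by (auto elim!: truthE)
      have "(\<beta> \<oplus> \<gamma>, DOr \<phi> \<psi>) \<in> M" using *(2,3) by (rule closed2[OF _ _ dorI])
      then show "(\<alpha>, DOr \<phi> \<psi>) \<in> M" by (metis *(1) k_in_truth)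
    qed
  qed (auto elim!: truthE)
  show "truth (DAnd \<phi> \<psi>) = {meet ?B a b |a b. a \<in> truth \<phi> \<and> b \<in> truth \<psi>}"
  proof (rule truth_eqI)
    fix \<alpha>
    show "(\<alpha>, DAnd \<phi> \<psi>) \<in> M \<longleftrightarrow> k \<alpha> \<in> {meet ?B a b |a b. a \<in> truth \<phi> \<and> b \<in> truth \<psi>}"
    proof
      assume "(\<alpha>, DAnd \<phi> \<psi>) \<in> M"
      then obtain \<beta> \<gamma> where "(\<beta>, \<phi>) \<in> M" "(\<gamma>, \<psi>) \<in> M" "(\<alpha> \<doteq> \<beta> \<odot> \<gamma>) \<in> M"
        using dand_witness by blast
      then have "k \<beta> \<in> truth \<phi>" "k \<gamma> \<in> truth \<psi>" "k \<alpha> = meet ?B (k \<beta>) (k \<gamma>)"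
        by (simp_all add: k_eq)
      then show "k \<alpha> \<in> {meet ?B a b |a b. a \<in> truth \<phi> \<and> b \<in> truth \<psi>}" by blast
    next
      assume "k \<alpha> \<in> {meet ?B a b |a b. a \<in> truth \<phi> \<and> b \<in> truth \<psi>}"
      then obtain \<beta> \<gamma> where *: "k \<alpha> = k (\<beta> \<odot> \<gamma>)" "(\<beta>, \<phi>) \<in> M" "(\<gamma>, \<psi>) \<in> M"
        by (auto elim!: truthE)
      have "(\<beta> \<odot> \<gamma>, DAnd \<phi> \<psi>) \<in> M" using *(2,3) by (rule closed2[OF _ _ dandI])
      then show "(\<alpha>, DAnd \<phi> \<psi>) \<in> M" by (metis *(1) k_in_truth)
    qed
  qed (auto elim!: truthE)
qed

end

text \<open>Countability serves twice: it embeds the quotient into any infinite type, and it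
  enumerates the labelled formulas for the Henkin construction.\<close>

instance lb :: countable by countable_datatype
instance fm :: countable by countable_datatype

text \<open>The canonical model is countable, so it fits inside \<open>'b\<close>: each label goes
  to its chosen representative \<open>r\<close>, then to a natural number, then along an injection
  into \<open>'b\<close>.\<close>

lemma (in henkin_set) not_entails:
  assumes "infinite (UNIV :: 'b set)" and "\<Gamma> \<subseteq> M" and "x \<notin> M"
  shows "\<not> entails TYPE('b) \<Gamma> x"
proof -
  obtain g :: "nat \<Rightarrow> 'b" where g: "inj g"
    using assms(1) infinite_countable_subset by blast
  define r where "r \<alpha> = (SOME \<beta>. (\<alpha> \<doteq> \<beta>) \<in> M)" for \<alpha>
  have r: "(\<alpha> \<doteq> r \<alpha>) \<in> M" for \<alpha>
    unfolding r_def by (rule someI[of _ \<alpha>]) (simp add: leq_taut)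
  have r_eq: "r \<alpha> = r \<beta> \<longleftrightarrow> (\<alpha> \<doteq> \<beta>) \<in> M" for \<alpha> \<beta>
  proof
    assume "r \<alpha> = r \<beta>"
    then show "(\<alpha> \<doteq> \<beta>) \<in> M" by (metis r leq_sym leq_trans)
  next
    assume "(\<alpha> \<doteq> \<beta>) \<in> M"
    \<comment> \<open>Provably equal labels have the same set of equals, so \<open>SOME\<close>
      selects the same representative for both.\<close>
    then have "(\<alpha> \<doteq> \<gamma>) \<in> M \<longleftrightarrow> (\<beta> \<doteq> \<gamma>) \<in> M" for \<gamma> by (blast intro: leq_sym leq_trans)
    then show "r \<alpha> = r \<beta>" unfolding r_def by simp
  qed
  define k where "k \<alpha> = g (to_nat (r \<alpha>))" for \<alpha>
  interpret henkin_quotient M k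
    by unfold_locales (simp add: k_def inj_eq[OF g] r_eq)
  have "\<forall>(\<alpha>, \<phi>) \<in> \<Gamma>. k \<alpha> \<in> truth \<phi>" using assms(2) by auto
  moreover have "k (fst x) \<notin> truth (snd x)" using assms(3) by simp
  ultimately show ?thesis
    unfolding entails_def using boolean_alg_quot lb_hom_quot fm_hom_truth by blast
qed

section \<open>Extension to a Henkin set\<close>

text \<open>An infinite reserve of fresh atoms is carried along so that every stage can still find
  two eigenatoms.\<close>

definition extendible :: "lfm set \<Rightarrow> bool" where
  "extendible \<Gamma> \<longleftrightarrow> consistent \<Gamma> \<and> infinite {p. fresh p \<Gamma>}"

definition witnessed :: "lfm set \<Rightarrow> lfm \<Rightarrow> bool" where
  "witnessed \<Gamma> x \<longleftrightarrow> (case x of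
     (\<alpha>, DAnd \<phi> \<psi>) \<Rightarrow> \<exists>\<beta> \<gamma>. (\<beta>, \<phi>) \<in> \<Gamma> \<and> (\<gamma>, \<psi>) \<in> \<Gamma> \<and> (\<alpha> \<doteq> \<beta> \<odot> \<gamma>) \<in> \<Gamma>
   | (\<alpha>, DOr \<phi> \<psi>) \<Rightarrow> \<exists>\<beta> \<gamma>. (\<beta>, \<phi>) \<in> \<Gamma> \<and> (\<gamma>, \<psi>) \<in> \<Gamma> \<and> (\<alpha> \<doteq> \<beta> \<oplus> \<gamma>) \<in> \<Gamma>
   | _ \<Rightarrow> True)"

lemma infinite_fresh_Un:
  assumes "infinite {p. fresh p \<Gamma>}" and "finite W"
  shows "infinite {p. fresh p (\<Gamma> \<union> W)}"
proof -
  have "{p. fresh p \<Gamma>} - (\<Union>x\<in>W. atoms (fst x)) \<subseteq> {p. fresh p (\<Gamma> \<union> W)}"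
    by (auto simp: fresh_def)
  moreover have "infinite ({p. fresh p \<Gamma>} - (\<Union>x\<in>W. atoms (fst x)))"
    using assms by (intro Diff_infinite_finite) auto
  ultimately show ?thesis by (rule infinite_super)
qed

text \<open>Either \<open>x\<close> can be added consistently, and its witnesses are added at the
  same time with two fresh atoms, or \<Gamma> stays unchanged. Only finitely many atoms are
  spent.\<close>

lemma extendible_step:
  assumes "extendible \<Gamma>"
  shows "\<exists>\<Gamma>'. extendible \<Gamma>' \<and> \<Gamma> \<subseteq> \<Gamma>' \<and>
    (x \<in> \<Gamma>' \<and> witnessed \<Gamma>' x \<or> \<not> consistent (insert x \<Gamma>))"
proof (cases "consistent (insert x \<Gamma>)")
  case False
  then show ?thesis using assms by blast
next
  case True
  let ?\<Gamma> = "insert x \<Gamma>"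
  have inf: "infinite {p. fresh p ?\<Gamma>}"
    using infinite_fresh_Un[of \<Gamma> "{x}"] assms unfolding extendible_def by simp
  obtain p where p: "fresh p ?\<Gamma>" using inf not_finite_existsD by blast
  have "infinite ({p. fresh p ?\<Gamma>} - {p})" using inf by simp
  then obtain q where q: "fresh q ?\<Gamma>" "p \<noteq> q" using not_finite_existsD[of "\<lambda>q. fresh q ?\<Gamma> \<and> q \<noteq> p"]
    by (auto simp: set_diff_eq)
  \<comment> \<open>The cases below differ only in the finite set \<open>W\<close> of witnessing
    assumptions.\<close>
  have suffices: ?thesis if "finite W" "consistent (?\<Gamma> \<union> W)" "witnessed (?\<Gamma> \<union> W) x" for W
    using that infinite_fresh_Un[OF inf that(1)] unfolding extendible_def
    by (intro exI[of _ "?\<Gamma> \<union> W"]) auto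
  obtain \<alpha> \<chi> where x: "x = (\<alpha>, \<chi>)" by (cases x)
  consider (dand) \<phi> \<psi> where "\<chi> = DAnd \<phi> \<psi>" | (dor) \<phi> \<psi> where "\<chi> = DOr \<phi> \<psi>"
    | (other) "\<forall>\<phi> \<psi>. \<chi> \<noteq> DAnd \<phi> \<psi> \<and> \<chi> \<noteq> DOr \<phi> \<psi>" by blast
  then show ?thesis
  proof cases
    case dand
    show ?thesis
      by (rule suffices[of "{(Atom p, \<phi>), (Atom q, \<psi>), \<alpha> \<doteq> Atom p \<odot> Atom q}"])
        (use dand x True p q in \<open>auto simp: witnessed_def simp del: Un_insert_right Un_insert_left
          intro!: consistent_dand_witness\<close>)
  next
    case dor
    show ?thesis
      by (rule suffices[of "{(Atom p, \<phi>), (Atom q, \<psi>), \<alpha> \<doteq> Atom p \<oplus> Atom q}"])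
        (use dor x True p q in \<open>auto simp: witnessed_def simp del: Un_insert_right Un_insert_left
          intro!: consistent_dor_witness\<close>)
  next
    case other
    show ?thesis by (rule suffices[of "{}"]) (use other x True in \<open>auto simp: witnessed_def split: fm.split\<close>)
  qed
qed

text \<open>A contradiction uses finitely many assumptions, which already lie together in one member
  of the chain.\<close>

lemma consistent_UN_chain:
  fixes G :: "nat \<Rightarrow> lfm set"
  assumes "mono G" and "\<And>n. consistent (G n)"
  shows "consistent (\<Union>n. G n)"
  unfolding consistent_def
proof (intro allI notI)
  fix \<beta> assume "derivable (\<Union>n. G n) (\<beta>, Bot)"
  then obtain \<Delta> where \<Delta>: "\<Delta> \<subseteq> (\<Union>n. G n)" "deriv \<Delta> (\<beta>, Bot)"
    unfolding derivable_def by blast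
  have "\<exists>n. \<Delta> \<subseteq> G n" using deriv_finite[OF \<Delta>(2)] \<Delta>(1)
  proof (induction rule: finite_induct)
    case (insert y \<Delta>)
    then obtain m n where "\<Delta> \<subseteq> G m" "y \<in> G n" by auto
    moreover have "G m \<subseteq> G (max m n)" "G n \<subseteq> G (max m n)" 
      by (intro monoD[OF assms(1)]; simp)+
    ultimately have "insert y \<Delta> \<subseteq> G (max m n)" by blast
    then show ?case by blast
  qed simp
  then show False using \<Delta>(2) assms(2) unfolding consistent_def derivable_def by blast
qed

lemma witnessed_mono: "witnessed \<Gamma> x \<Longrightarrow> \<Gamma> \<subseteq> \<Gamma>' \<Longrightarrow> witnessed \<Gamma>' x"
  by (auto simp: witnessed_def split: prod.splits fm.splits)

text \<open>Lindenbaum's construction along an enumeration: stage \<open>n\<close> treats the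
  formula \<open>from_nat n\<close>, and the union of all stages is the Henkin set.\<close>

lemma henkin_extension:
  assumes "extendible \<Gamma>"
  obtains M where "\<Gamma> \<subseteq> M" and "henkin_set M"
proof -
  let ?R = "\<lambda>n S S'. S \<subseteq> S' \<and>
    (from_nat n \<in> S' \<and> witnessed S' (from_nat n) \<or> \<not> consistent (insert (from_nat n) S))"
  \<comment> \<open>The invariant of the dependent choice also mentions the index, in order to pin
    the start of the chain to \<Gamma>.\<close>
  have "\<exists>G. \<forall>n. (extendible (G n) \<and> (n = 0 \<longrightarrow> G n = \<Gamma>)) \<and> ?R n (G n) (G (Suc n))"
  proof (rule dependent_nat_choice)
    show "\<exists>S. extendible S \<and> (0 = (0::nat) \<longrightarrow> S = \<Gamma>)" using assms by simp
    fix S and n :: nat assume "extendible S \<and> (n = 0 \<longrightarrow> S = \<Gamma>)"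
    then have "extendible S" ..
    from extendible_step[OF this, of "from_nat n"]
    show "\<exists>S'. (extendible S' \<and> (Suc n = 0 \<longrightarrow> S' = \<Gamma>)) \<and> ?R n S S'" by simp
  qed
  then obtain G where G: "\<forall>n. (extendible (G n) \<and> (n = 0 \<longrightarrow> G n = \<Gamma>)) \<and> ?R n (G n) (G (Suc n))" ..
  have G0: "G 0 = \<Gamma>" and ext: "extendible (G n)" and step: "?R n (G n) (G (Suc n))" for n
    using G by simp_all
  have mono: "mono G" using step by (intro monoI) (rule lift_Suc_mono_le[of G], simp_all)
  define M where "M = (\<Union>n. G n)"
  have sub: "G n \<subseteq> M" for n unfolding M_def by blast
  have con: "consistent M"
    unfolding M_def using mono ext by (intro consistent_UN_chain) (auto simp: extendible_def)
  \<comment> \<open>A formula outside \<open>M\<close> was rejected at its own stage, so it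
    contradicts that stage and \<open>derivable_negI\<close> yields its negation.\<close>
  have refuted: "derivable M (\<alpha>, Neg \<phi>)" if notin: "(\<alpha>, \<phi>) \<notin> M" for \<alpha> \<phi>
  proof -
    have "\<not> consistent (insert (\<alpha>, \<phi>) (G (to_nat (\<alpha>, \<phi>))))"
      using step[of "to_nat (\<alpha>, \<phi>)"] notin sub by auto
    then obtain \<beta> where "derivable (insert (\<alpha>, \<phi>) (G (to_nat (\<alpha>, \<phi>)))) (\<beta>, Bot)"
      unfolding consistent_def by blast
    then show ?thesis by (rule derivable_mono[OF derivable_negI sub])
  qed
  have clash: False if "derivable M (\<alpha>, \<phi>)" "derivable M (\<alpha>, Neg \<phi>)" for \<alpha> \<phi>
  proof -
    have "derivable M (\<alpha>, Bot)" by (rule derivable_lift2[OF that]) (rule negE)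
    then show False using con unfolding consistent_def by blast
  qed
  \<comment> \<open>A member of the consistent set \<open>M\<close> is consistent with the stage
    that treats it, so that stage accepted it together with its witnesses.\<close>
  have wit: "witnessed M x" if "x \<in> M" for x
  proof -
    let ?n = "to_nat x"
    have "consistent (insert x (G ?n))"
      using con derivable_mono[of "insert x (G ?n)" _ M] that sub[of ?n] unfolding consistent_def
      by blast
    then have "witnessed (G (Suc ?n)) x" using step[of ?n] by simp
    then show ?thesis using sub by (rule witnessed_mono)
  qed
  have "henkin_set M"
  proof
    \<comment> \<open>If a derivable formula were missing from \<open>M\<close>, its negation would
      be derivable too.\<close>
    show closed: "x \<in> M" if "derivable M x" for x
      using that refuted clash by (cases x) blast
    show "(\<alpha>, Bot) \<notin> M" for \<alpha>
      using con derivable_assm unfolding consistent_def by blast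
    show "(\<alpha>, \<phi>) \<in> M \<or> (\<alpha>, Neg \<phi>) \<in> M" for \<alpha> \<phi>
      using refuted closed by blast
    show "\<exists>\<beta> \<gamma>. (\<beta>, \<phi>) \<in> M \<and> (\<gamma>, \<psi>) \<in> M \<and> (\<alpha> \<doteq> \<beta> \<odot> \<gamma>) \<in> M" if "(\<alpha>, DAnd \<phi> \<psi>) \<in> M" for \<alpha> \<phi> \<psi>
      using wit[OF that] by (simp add: witnessed_def)
    show "\<exists>\<beta> \<gamma>. (\<beta>, \<phi>) \<in> M \<and> (\<gamma>, \<psi>) \<in> M \<and> (\<alpha> \<doteq> \<beta> \<oplus> \<gamma>) \<in> M" if "(\<alpha>, DOr \<phi> \<psi>) \<in> M" for \<alpha> \<phi> \<psi>
      using wit[OF that] by (simp add: witnessed_def)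
  qed
  then show thesis using that sub[of 0] G0 by blast
qed

section \<open>Completeness, first with infinitely many fresh atoms and then in general\<close>

lemma derivable_if_entails:
  assumes "infinite (UNIV :: 'b set)" and "infinite {p. fresh p \<Gamma>}"
    and "entails TYPE('b) \<Gamma> x"
  shows "derivable \<Gamma> x"
proof (rule ccontr)
  obtain \<alpha> \<phi> where x: "x = (\<alpha>, \<phi>)" by (cases x)
  assume "\<not> derivable \<Gamma> x"
  \<comment> \<open>A contradiction from the enlarged set would give a derivation of
    \<open>x\<close> by \<open>raa\<close>.\<close>
  then have "consistent (insert (\<alpha>, Neg \<phi>) \<Gamma>)"
    unfolding consistent_def x using derivable_raa by blast
  moreover have "infinite {p. fresh p (insert (\<alpha>, Neg \<phi>) \<Gamma>)}"
    using infinite_fresh_Un[OF assms(2), of "{(\<alpha>, Neg \<phi>)}"] by simp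
  ultimately obtain M where M: "insert (\<alpha>, Neg \<phi>) \<Gamma> \<subseteq> M" "henkin_set M"
    using henkin_extension unfolding extendible_def by blast
  interpret henkin_set M by (rule M(2))
  have "x \<notin> M" using M(1) Neg_iff unfolding x by blast
  then show False using not_entails[OF assms(1), of \<Gamma> x] M(1) assms(3) by blast
qed

text \<open>Countermodels are countable, so the algebras with carrier in one infinite type detect
  every failure of derivability.\<close>

theorem theorem3p6:
  fixes \<Gamma> :: "lfm set" and \<alpha> :: lb and \<phi> :: fm
  assumes "infinite (UNIV :: 'b set)"
    and "entails TYPE('b) \<Gamma> (\<alpha>, \<phi>)"
  shows "derivable \<Gamma> (\<alpha>, \<phi>)"
proof (rule derivable_unshift, rule derivable_if_entails[OF assms(1)])
  let ?d = "(*) 2 :: nat \<Rightarrow> nat"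
  \<comment> \<open>Doubling all atoms makes every odd atom fresh, which provides the infinite
    reserve whatever atoms \<Gamma> uses.\<close>
  have "fresh p (ren_lfm ?d ` \<Gamma>)" if "odd p" for p
    using that by (auto simp: fresh_def atoms_ren)
  then have "range (\<lambda>n. 2 * n + 1) \<subseteq> {p. fresh p (ren_lfm ?d ` \<Gamma>)}" by auto
  moreover have "infinite (range (\<lambda>n::nat. 2 * n + 1))" by (simp add: finite_image_iff inj_on_def)
  ultimately show "infinite {p. fresh p (ren_lfm ?d ` \<Gamma>)}" by (rule infinite_super)
  show "entails TYPE('b) (ren_lfm ?d ` \<Gamma>) (ren_lfm ?d (\<alpha>, \<phi>))"
    using assms(2) by (rule entails_ren)
qed

end
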